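(* Let $G$ and $H$ be non-empty graphs. Then $\operatorname{avd}(G \,\Box\, H) > \operatorname{avd}(G)\operatorname{avd}(H)$.
   Context: Graphs are finite and simple. A graph is non-empty if it has at least one edge (the empty graph on $n$ vertices is the edgeless graph $\overline{K_n}$). For a vertex $v$ of a graph $G$, $N(v)=\{u : uv\in E(G)\}$ and $N[v]=N(v)\cup\{v\}$; for $S\subseteq V(G)$, $N[S]=\bigcup_{v\in S}N[v]$. A set $S\subseteq V(G)$ is a dominating set of $G$ if $N[S]=V(G)$. Let $\mathcal{D}_G$ be the collection of all dominating sets of $G$. The average order of dominating sets in $G$ is $$\operatorname{avd}(G)=\frac{\sum_{S\in\mathcal{D}_G}|S|}{|\mathcal{D}_G|}.$$ $G\,\Box\, H$ denotes the Cartesian product of graphs: its vertex set is $V(G)\times V(H)$, and $(g,h)$ is adjacent to $(g',h')$ if and only if either $g=g'$ and $hh'\in E(H)$, or $h=h'$ and $gg'\in E(G)$. *)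

theory Defs
  imports Complex_Main "Graph_Theory.Pair_Digraph"
begin

text \<open>
  A finite simple graph is a \<^locale>\<open>pair_graph\<close>: a finite loop-free digraph with a
  symmetric arc relation, so that an edge \<open>uv\<close> is the pair of arcs \<open>(u, v)\<close> and \<open>(v, u)\<close>.
\<close>

definition nbhd :: "'a pair_pre_digraph \<Rightarrow> 'a \<Rightarrow> 'a set" where
  "nbhd G v = {u. (u, v) \<in> parcs G}"

definition closed_nbhd :: "'a pair_pre_digraph \<Rightarrow> 'a \<Rightarrow> 'a set" where
  "closed_nbhd G v = nbhd G v \<union> {v}"

definition closed_nbhd_set :: "'a pair_pre_digraph \<Rightarrow> 'a set \<Rightarrow> 'a set" where
  "closed_nbhd_set G S = (\<Union>v\<in>S. closed_nbhd G v)"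

definition dominating_set :: "'a pair_pre_digraph \<Rightarrow> 'a set \<Rightarrow> bool" where
  "dominating_set G S \<longleftrightarrow> S \<subseteq> pverts G \<and> closed_nbhd_set G S = pverts G"

definition dominating_sets :: "'a pair_pre_digraph \<Rightarrow> 'a set set" where
  "dominating_sets G = {S. dominating_set G S}"

definition avd :: "'a pair_pre_digraph \<Rightarrow> real" where
  "avd G = (\<Sum>S\<in>dominating_sets G. real (card S)) / real (card (dominating_sets G))"

definition cartesian_product ::
  "'a pair_pre_digraph \<Rightarrow> 'b pair_pre_digraph \<Rightarrow> ('a \<times> 'b) pair_pre_digraph"
  (infixl \<open>\<box>\<close> 70) where
  "G \<box> H =
    \<lparr> pverts = pverts G \<times> pverts H,
      parcs = {((g, h), (g', h')) | g h g' h'.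
        (g \<in> pverts G \<and> g = g' \<and> (h, h') \<in> parcs H) \<or>
        (h \<in> pverts H \<and> h = h' \<and> (g, g') \<in> parcs G)} \<rparr>"

lemma pair_graph_cartesian_product:
  assumes "pair_graph G" "pair_graph H"
  shows "pair_graph (G \<box> H)"
proof -
  interpret G: pair_graph G by fact
  interpret H: pair_graph H by fact
  have sub: "parcs (G \<box> H) \<subseteq> (pverts G \<times> pverts H) \<times> (pverts G \<times> pverts H)"
    by (auto simp: cartesian_product_def dest: G.wellformed' H.wellformed')
  have sG: "sym (parcs G)" and sH: "sym (parcs H)"
    using G.pair_sym_arcs H.pair_sym_arcs by (simp_all add: symmetric_def)
  have fin: "finite (pverts G \<times> pverts H)"
    using G.pair_finite_verts H.pair_finite_verts by simp
  show ?thesis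
  proof unfold_locales
    fix e assume e: "e \<in> parcs (G \<box> H)"
    show "fst e \<in> pverts (G \<box> H)" "snd e \<in> pverts (G \<box> H)"
      using e by (auto simp: cartesian_product_def dest: G.wellformed' H.wellformed')
    show "fst e \<noteq> snd e"
      using e G.pair_no_loops H.pair_no_loops by (fastforce simp: cartesian_product_def)
  next
    show "finite (pverts (G \<box> H))"
      using fin by (simp add: cartesian_product_def)
    show "finite (parcs (G \<box> H))"
      by (rule finite_subset[OF sub]) (intro finite_cartesian_product fin)
    show "symmetric (with_proj (G \<box> H))"
      using sG sH by (auto simp: symmetric_def cartesian_product_def sym_def)
  qed
qed

lemma finite_dominating_sets:
  assumes "pair_graph G"
  shows "finite (dominating_sets G)"
proof -
  interpret pair_graph G by fact
  have "dominating_sets G \<subseteq> Pow (pverts G)"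
    by (auto simp: dominating_sets_def dominating_set_def)
  then show ?thesis
    using pair_finite_verts finite_subset by blast
qed

lemma pverts_in_dominating_sets:
  assumes "pair_graph G"
  shows "pverts G \<in> dominating_sets G"
proof -
  interpret pair_graph G by fact
  show ?thesis
    by (auto simp: dominating_sets_def dominating_set_def closed_nbhd_set_def
        closed_nbhd_def nbhd_def dest: wellformed')
qed

end

theory Submission
  imports Defs
begin

text \<open>
  Call \<open>v \<in> S\<close> critical in a dominating set \<open>S\<close> if \<open>S - {v}\<close> is not dominating. Removing a
  non-critical vertex is inverse to adding a vertex, so, over all dominating sets, the non-critical
  members are as numerous as the non-members; hence \<open>avd G \<ge> n / 2\<close>. If \<open>G\<close> has no isolated
  vertices, the pairs \<open>(S, v)\<close> with \<open>v\<close> critical in \<open>S\<close> inject into the pairs \<open>(T, u)\<close> with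
  \<open>u \<notin> T\<close>; then at most two thirds of all incidences are memberships, so \<open>avd G \<le> 2 n / 3\<close>.
  Without isolated vertices the theorem follows from \<open>(2 / 3)\<^sup>2 < 1 / 2\<close>. An isolated vertex \<open>g\<close> of
  \<open>G\<close> contributes a disjoint copy of \<open>H\<close> to \<open>G \<box> H\<close> and adds \<open>1\<close> to \<open>avd G\<close>, so isolated
  vertices can be split off one at a time.
\<close>

section \<open>Neighbourhoods and domination\<close>

lemma dominating_sets_iff:
  assumes "pair_graph G"
  shows "S \<in> dominating_sets G \<longleftrightarrow>
    S \<subseteq> pverts G \<and> (\<forall>x\<in>pverts G. x \<in> S \<or> nbhd G x \<inter> S \<noteq> {})"
proof -
  interpret pair_graph G by fact
  have sym: "(x, y) \<in> parcs G \<longleftrightarrow> (y, x) \<in> parcs G" for x y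
    using pair_sym_arcs by (auto simp: symmetric_def sym_def)
  show ?thesis
    using sym wellformed'
    unfolding dominating_sets_def dominating_set_def closed_nbhd_set_def closed_nbhd_def nbhd_def
    by blast
qed

lemma nbhd_sym:
  assumes "pair_graph G"
  shows "u \<in> nbhd G v \<longleftrightarrow> v \<in> nbhd G u"
proof -
  interpret pair_graph G by fact
  show ?thesis
    using pair_sym_arcs by (auto simp: symmetric_def sym_def nbhd_def)
qed

lemma nbhd_subset_pverts:
  assumes "pair_graph G"
  shows "nbhd G v \<subseteq> pverts G"
proof -
  interpret pair_graph G by fact
  show ?thesis by (auto simp: nbhd_def dest: wellformed')
qed

lemma not_in_nbhd_self:
  assumes "pair_graph G"
  shows "v \<notin> nbhd G v"
proof -
  interpret pair_graph G by fact
  show ?thesis using pair_no_loops by (force simp: nbhd_def)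
qed

section \<open>Counting incidences in families of sets\<close>

definition members :: "'a set set \<Rightarrow> ('a set \<times> 'a) set" where
  "members F = Sigma F (\<lambda>S. S)"

definition nonmembers :: "'a set \<Rightarrow> 'a set set \<Rightarrow> ('a set \<times> 'a) set" where
  "nonmembers V F = Sigma F (\<lambda>S. V - S)"

definition criticals :: "'a set set \<Rightarrow> ('a set \<times> 'a) set" where
  "criticals F = {(S, v). S \<in> F \<and> v \<in> S \<and> S - {v} \<notin> F}"

lemma card_members_add_nonmembers:
  assumes "finite V" and "F \<subseteq> Pow V"
  shows "card (members F) + card (nonmembers V F) = card F * card V"
proof -
  have fin: "finite F" using assms finite_subset by blast
  have finS: "finite S" if "S \<in> F" for S using assms that finite_subset by blast
  have "card (members F) + card (nonmembers V F) = (\<Sum>S\<in>F. card S + card (V - S))"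
    using fin finS assms(1) by (simp add: members_def nonmembers_def sum.distrib)
  also have "\<dots> = (\<Sum>S\<in>F. card V)"
    using assms by (intro sum.cong refl)
      (metis PowD card_Diff_subset card_mono finS le_add_diff_inverse subsetD)
  finally show ?thesis by simp
qed

text \<open>Of domination, the argument uses just upward closure: a vertex may be added to a set of
  the family without leaving it.\<close>

lemma card_members_upset:
  assumes "finite V" and "F \<subseteq> Pow V"
    and up: "\<And>S v. S \<in> F \<Longrightarrow> v \<in> V \<Longrightarrow> insert v S \<in> F"
  shows "card (members F) = card (criticals F) + card (nonmembers V F)"
proof -
  have fin: "finite (members F)"
    unfolding members_def using assms
    by (meson PowD finite_Pow_iff finite_SigmaI finite_subset subsetD)
  have sub: "criticals F \<subseteq> members F"
    by (auto simp: criticals_def members_def)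
  have "bij_betw (\<lambda>(S, v). (insert v S, v)) (nonmembers V F) (members F - criticals F)"
    using assms(2)
    by (intro bij_betwI[where g = "\<lambda>(S, v). (S - {v}, v)"])
      (auto simp: nonmembers_def members_def criticals_def insert_absorb intro: up)
  then have "card (nonmembers V F) = card (members F - criticals F)"
    by (rule bij_betw_same_card)
  then show ?thesis
    using fin sub by (simp add: card_Diff_subset finite_subset card_mono)
qed

lemma dominating_sets_upset:
  assumes "pair_graph G" "S \<in> dominating_sets G" "v \<in> pverts G"
  shows "insert v S \<in> dominating_sets G"
  using assms by (auto simp: dominating_sets_iff)

section \<open>Private neighbours and the charging relation\<close>

definition external_private :: "'a pair_pre_digraph \<Rightarrow> 'a set \<Rightarrow> 'a \<Rightarrow> 'a \<Rightarrow> bool" where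
  "external_private G S v u \<longleftrightarrow> u \<in> pverts G - S \<and> nbhd G u \<inter> S = {v}"

definition leaves_at :: "'a pair_pre_digraph \<Rightarrow> 'a \<Rightarrow> 'a set" where
  "leaves_at G w = {v. nbhd G v = {w}}"

text \<open>Several leaves at \<open>w\<close> may be self-private in the same \<open>S\<close> and
  cannot all charge \<open>(S, w)\<close>. One of them is singled out for that target; the others
  get a set in which \<open>w\<close> replaces its leaves.\<close>

definition chosen_leaf :: "'a pair_pre_digraph \<Rightarrow> 'a \<Rightarrow> 'a" where
  "chosen_leaf G w = (SOME v. v \<in> leaves_at G w)"

text \<open>Here \<open>v\<close> is its own only private neighbour: \<open>S - {v}\<close> fails to
  dominate \<open>v\<close> and dominates everything else.\<close>

definition self_private :: "'a pair_pre_digraph \<Rightarrow> 'a set \<Rightarrow> 'a \<Rightarrow> bool" where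
  "self_private G S v \<longleftrightarrow> S \<in> dominating_sets G \<and> v \<in> S \<and> nbhd G v \<inter> S = {} \<and>
    (\<forall>u. \<not> external_private G S v u)"

text \<open>
  Injectivity rests on counting the neighbours of \<open>u\<close> in \<open>T\<close> for a charged pair \<open>(T, u)\<close>: exactly
  one in the cases \<open>external\<close> and \<open>leaf\<close>, at least two in the cases \<open>inner\<close> and \<open>chosen\<close>. The last
  premise of \<open>external\<close> keeps it away from \<open>leaf\<close>: there \<open>w\<close> has all its leaves as private
  neighbours, and it charges the chosen one. If \<open>w\<close> has no leaf, \<open>chosen_leaf G w\<close> is arbitrary,
  which does no harm.
\<close>

inductive charge :: "'a pair_pre_digraph \<Rightarrow> 'a set \<times> 'a \<Rightarrow> 'a set \<times> 'a \<Rightarrow> bool"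
  for G where
  external: "charge G (S, v) (S, u)"
    if "S \<in> dominating_sets G" "external_private G S v u"
      "external_private G S v (chosen_leaf G v) \<Longrightarrow> u = chosen_leaf G v"
| inner: "charge G (S, v) (S - {v} \<union> nbhd G v, v)"
    if "self_private G S v" "nbhd G v \<noteq> {}" "\<And>w. nbhd G v \<noteq> {w}"
| chosen: "charge G (S, v) (S, w)"
    if "self_private G S v" "nbhd G v = {w}" "v = chosen_leaf G w"
| leaf: "charge G (S, v) (S - leaves_at G w \<union> {w}, v)"
    if "self_private G S v" "nbhd G v = {w}" "v \<noteq> chosen_leaf G w"

lemma chosen_leaf_in_leaves_at: "v \<in> leaves_at G w \<Longrightarrow> chosen_leaf G w \<in> leaves_at G w"
  unfolding chosen_leaf_def by (rule someI)

text \<open>A vertex left undominated by \<open>S - {v}\<close> had no dominator in \<open>S\<close>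
  other than \<open>v\<close>: it is \<open>v\<close> itself or an external private neighbour of
  \<open>v\<close>.\<close>

lemma criticals_cases:
  assumes "pair_graph G" and "(S, v) \<in> criticals (dominating_sets G)"
  shows "(\<exists>u. external_private G S v u) \<or> self_private G S v"
proof -
  have S: "S \<in> dominating_sets G" "v \<in> S" "S - {v} \<notin> dominating_sets G"
    using assms(2) by (auto simp: criticals_def)
  then obtain x where x: "x \<in> pverts G" "x \<notin> S - {v}" "nbhd G x \<inter> (S - {v}) = {}"
    using assms(1) by (auto simp: dominating_sets_iff)
  show ?thesis
  proof (cases "x = v")
    case True
    then have "nbhd G v \<inter> S = {}"
      using x not_in_nbhd_self[OF assms(1)] by blast
    then show ?thesis using S by (auto simp: self_private_def)
  next
    case False
    then have "x \<notin> S" using x by blast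
    then have "nbhd G x \<inter> S \<noteq> {}"
      using S x assms(1) by (auto simp: dominating_sets_iff)
    then have "nbhd G x \<inter> S = {v}" using x by blast
    then show ?thesis using \<open>x \<notin> S\<close> x by (auto simp: external_private_def)
  qed
qed

text \<open>The neighbour \<open>u\<close> lies outside \<open>S\<close> and sees \<open>v\<close>;
  since \<open>u\<close> is not an external private neighbour of \<open>v\<close>, it sees a second
  vertex of \<open>S\<close>.\<close>

lemma self_private_neighbour:
  assumes "pair_graph G" "self_private G S v" "u \<in> nbhd G v"
  obtains y where "y \<in> nbhd G u" "y \<in> S" "y \<noteq> v"
proof -
  have "u \<notin> S" "v \<in> S" "u \<in> pverts G"
    using assms nbhd_subset_pverts[OF assms(1)] by (auto simp: self_private_def)
  moreover have "v \<in> nbhd G u" using assms nbhd_sym by metis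
  moreover have "\<not> external_private G S v u" using assms by (simp add: self_private_def)
  ultimately show ?thesis using that unfolding external_private_def by blast
qed

text \<open>A leaf at \<open>w\<close> can be dominated only by itself or by
  \<open>w\<close>.\<close>

lemma leaves_at_subset:
  assumes "pair_graph G" "S \<in> dominating_sets G" "w \<notin> S"
  shows "leaves_at G w \<subseteq> S"
proof
  fix x assume x: "x \<in> leaves_at G w"
  then have "w \<in> nbhd G x" by (simp add: leaves_at_def)
  then have "x \<in> pverts G" 
    using nbhd_subset_pverts[OF assms(1)] nbhd_sym[OF assms(1)] by blast
  then show "x \<in> S"
    using assms x by (auto simp: leaves_at_def dominating_sets_iff)
qed

text \<open>An isolated vertex is critical in every dominating set, but no rule of
  \<open>charge\<close> covers it; hence the hypothesis on \<open>nbhd\<close>.\<close>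

lemma charge_total:
  assumes G: "pair_graph G" and nbhd: "\<And>v. v \<in> pverts G \<Longrightarrow> nbhd G v \<noteq> {}"
    and crit: "(S, v) \<in> criticals (dominating_sets G)"
  shows "\<exists>q. charge G (S, v) q"
proof -
  have S: "S \<in> dominating_sets G" and "v \<in> S"
    using crit by (auto simp: criticals_def)
  then have "nbhd G v \<noteq> {}" using G nbhd by (auto simp: dominating_sets_iff)
  \<comment> \<open>If external private neighbours exist, rule \<open>external\<close> takes the
    chosen leaf when it is one of them, and any of them otherwise.\<close>
  then show ?thesis
    using criticals_cases[OF G crit] S charge.intros[where G = G] by metis
qed

lemma charge_nonmember:
  assumes G: "pair_graph G" and "charge G p q"
  shows "q \<in> nonmembers (pverts G) (dominating_sets G)"
  using assms(2)
proof cases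
  case (external S v u)
  then show ?thesis by (auto simp: nonmembers_def external_private_def)
next
  case (inner S v)
  let ?T = "S - {v} \<union> nbhd G v"
  have sub: "S \<subseteq> pverts G" "v \<in> S"
    and dom: "\<And>x. x \<in> pverts G \<Longrightarrow> x \<in> S \<or> nbhd G x \<inter> S \<noteq> {}"
    using inner G by (auto simp: self_private_def dominating_sets_iff)
  have "x \<in> ?T \<or> nbhd G x \<inter> ?T \<noteq> {}" if "x \<in> pverts G" for x
  \<comment> \<open>Only \<open>v\<close> and its neighbours can suffer from the loss of
    \<open>v\<close>; the neighbours now belong to \<open>?T\<close>, and they dominate
    \<open>v\<close>.\<close>
  proof (cases "x = v \<or> x \<in> nbhd G v")
    case True
    then show ?thesis using inner by blast
  next
    case False
    then have "v \<notin> nbhd G x" using nbhd_sym[OF G] by blast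
    then show ?thesis using False dom[OF that] by blast
  qed
  then have "?T \<in> dominating_sets G"
    using sub nbhd_subset_pverts[OF G] by (auto simp: dominating_sets_iff[OF G])
  then show ?thesis
    using inner sub not_in_nbhd_self[OF G] by (auto simp: nonmembers_def)
next
  case (chosen S v w)
  then show ?thesis
    using nbhd_subset_pverts[OF G, of v] by (auto simp: nonmembers_def self_private_def)
next
  case (leaf S v w)
  let ?T = "S - leaves_at G w \<union> {w}"
  have sub: "S \<subseteq> pverts G" "v \<in> S" "w \<notin> S"
    and dom: "\<And>x. x \<in> pverts G \<Longrightarrow> x \<in> S \<or> nbhd G x \<inter> S \<noteq> {}"
    using leaf G by (auto simp: self_private_def dominating_sets_iff)
  have "x \<in> ?T \<or> nbhd G x \<inter> ?T \<noteq> {}" if "x \<in> pverts G" for x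
  \<comment> \<open>The removed leaves are adjacent to \<open>w\<close> alone, and \<open>w\<close>
    now belongs to \<open>?T\<close> and dominates them.\<close>
  proof (cases "x = w \<or> x \<in> leaves_at G w")
    case True
    then show ?thesis by (auto simp: leaves_at_def)
  next
    case False
    then have "nbhd G x \<inter> leaves_at G w = {}"
      using nbhd_sym[OF G] by (auto simp: leaves_at_def)
    then show ?thesis using False dom[OF that] by blast
  qed
  moreover have "w \<in> pverts G" using leaf nbhd_subset_pverts[OF G] by blast
  ultimately have "?T \<in> dominating_sets G"
    using sub by (auto simp: dominating_sets_iff[OF G])
  moreover have "v \<in> leaves_at G w" using leaf by (simp add: leaves_at_def)
  ultimately show ?thesis
    using leaf sub by (auto simp: nonmembers_def)
qed

text \<open>Within one rule the target determines the source: \<open>external\<close> reads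
  \<open>v\<close> off \<open>nbhd G u \<inter> S\<close>, \<open>inner\<close> and
  \<open>leaf\<close> undo their exchange, and \<open>chosen\<close> has
  \<open>v = chosen_leaf G w\<close>. The mixed cases are contradictory.\<close>

lemma charge_inj:
  assumes G: "pair_graph G" and "charge G p q" and "charge G p' q"
  shows "p = p'"
proof -
  \<comment> \<open>For rule \<open>chosen\<close>: \<open>w\<close> sees \<open>v\<close> and, by
    \<open>self_private_neighbour\<close>, another vertex of \<open>S\<close>.\<close>
  have two: "\<nexists>w'. nbhd G w \<inter> S = {w'}" if v: "self_private G S v" "nbhd G v = {w}" for S v w
  proof -
    have "v \<in> nbhd G w \<inter> S"
      using v nbhd_sym[OF G, of w v] by (auto simp: self_private_def)
    moreover obtain y where "y \<in> nbhd G w \<inter> S" "y \<noteq> v"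
      using self_private_neighbour[OF G v(1), of w] v(2) by blast
    ultimately show ?thesis by (metis singletonD)
  qed
  have external_leaf: False
    if "external_private G (S - leaves_at G w \<union> {w}) v u"
      "external_private G (S - leaves_at G w \<union> {w}) v (chosen_leaf G v) \<Longrightarrow> u = chosen_leaf G v"
      "self_private G S u" "nbhd G u = {w}" "u \<noteq> chosen_leaf G w" for S v u w
  proof -
    have "v \<in> nbhd G u" using that(1) unfolding external_private_def by blast
    then have "v = w" using that(4) by simp
    have u: "u \<in> leaves_at G w" using that by (simp add: leaves_at_def)
    then have c: "chosen_leaf G w \<in> leaves_at G w" by (rule chosen_leaf_in_leaves_at)
    then have nbhd_c: "nbhd G (chosen_leaf G w) = {w}" by (simp add: leaves_at_def)
    then have "chosen_leaf G w \<in> nbhd G w"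
      using nbhd_sym[OF G, of "chosen_leaf G w" w] by simp
    then have "chosen_leaf G w \<in> pverts G" "chosen_leaf G w \<noteq> w"
      using nbhd_subset_pverts[OF G, of w] not_in_nbhd_self[OF G, of w] by auto
    then have "external_private G (S - leaves_at G w \<union> {w}) w (chosen_leaf G w)"
      using c nbhd_c by (simp add: external_private_def)
    then show False using that(2,5) \<open>v = w\<close> by simp
  qed
  \<comment> \<open>A vertex with a leaf is never self-private, since the leaf would need a second
    neighbour. So the target vertex of \<open>chosen\<close> differs from those of
    \<open>inner\<close> and \<open>leaf\<close>.\<close>
  have inner_chosen: False
    if w: "self_private G S w" "nbhd G v = {w}" for S v w
  proof -
    have "v \<in> nbhd G w" using w(2) nbhd_sym[OF G, of v w] by simp
    then obtain y where "y \<in> nbhd G v" "y \<noteq> w"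
      using self_private_neighbour[OF G w(1), of v] by blast
    then show False using w(2) by blast
  qed
  have inner_two: "\<nexists>w. nbhd G v \<inter> (S - {v} \<union> nbhd G v) = {w}" if "\<And>w. nbhd G v \<noteq> {w}" for S v
    using that by (simp add: Int_absorb2)
  \<comment> \<open>As \<open>w\<close> lies outside \<open>S\<close>, all leaves at
    \<open>w\<close> lie in \<open>S\<close>, so putting every one of them back restores
    \<open>S\<close>.\<close>
  have leaf_S: "S = (T - {w}) \<union> leaves_at G w"
    if "T = S - leaves_at G w \<union> {w}" "self_private G S v" "nbhd G v = {w}" for S T v w
  proof -
    have "S \<in> dominating_sets G" "w \<notin> S" using that(2,3) by (auto simp: self_private_def)
    then show ?thesis using that(1) leaves_at_subset[OF G, of S w] by blast
  qed
  \<comment> \<open>\<open>S\<close> misses \<open>nbhd G v\<close>, so deleting this set removes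
    exactly what the exchange added.\<close>
  have inner_S: "S = T - nbhd G v \<union> {v}"
    if "T = S - {v} \<union> nbhd G v" "self_private G S v" for S T v
    using that not_in_nbhd_self[OF G, of v] unfolding self_private_def by blast
  from assms(2) show ?thesis
  proof cases
    case e: (external S v u)
    from assms(3) show ?thesis
    proof cases
      case (external S' v' u')
      then show ?thesis using e by (auto simp: external_private_def)
    next
      case (inner S' v')
      then show ?thesis using e inner_two[of v' S'] by (auto simp: external_private_def)
    next
      case (chosen S' v' w')
      then show ?thesis using e two[of S' v' w'] by (auto simp: external_private_def)
    next
      case (leaf S' v' w')
      then show ?thesis using e external_leaf[of S' w' v v'] by auto
    qed
  next
    case i: (inner S v)
    from assms(3) show ?thesis
    proof cases
      case (external S' v' u')
      then show ?thesis using i inner_two[of v S] by (auto simp: external_private_def)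
    next
      case (inner S' v')
      then have "S - {v} \<union> nbhd G v = S' - {v} \<union> nbhd G v" "v' = v" using i by auto
      then have "S' = S"
        using inner_S[OF refl \<open>self_private G S v\<close>] inner_S[OF refl \<open>self_private G S' v'\<close>] by simp
      then show ?thesis using i inner by simp
    next
      case (chosen S' v' w')
      then show ?thesis using i inner_chosen[of S v v'] by auto
    next
      case (leaf S' v' w')
      then show ?thesis using i by auto
    qed
  next
    case c: (chosen S v w)
    from assms(3) show ?thesis
    proof cases
      case (external S' v' u')
      then show ?thesis using c two[of S v w] by (auto simp: external_private_def)
    next
      case (inner S' v')
      then show ?thesis using c inner_chosen[of S' w v] by auto
    next
      case (chosen S' v' w')
      then show ?thesis using c by auto
    next
      case (leaf S' v' w')
      then show ?thesis using c inner_chosen[of S' w v] by auto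
    qed
  next
    case l: (leaf S v w)
    from assms(3) show ?thesis
    proof cases
      case (external S' v' u')
      then show ?thesis using l external_leaf[of S w v' v] by auto
    next
      case (inner S' v')
      then show ?thesis using l by auto
    next
      case (chosen S' v' w')
      then show ?thesis using l inner_chosen[of S w' v'] by auto
    next
      case (leaf S' v' w')
      have v: "v' = v" using l leaf by simp
      then have w: "w' = w" using l leaf by simp
      have "S - leaves_at G w \<union> {w} = S' - leaves_at G w \<union> {w}"
        using l leaf w by simp
      then have "S' = S"
        using leaf_S[OF refl \<open>self_private G S v\<close> \<open>nbhd G v = {w}\<close>]
          leaf_S[OF refl \<open>self_private G S' v'\<close> \<open>nbhd G v' = {w'}\<close>] w by simp
      then show ?thesis using l leaf v by simp
    qed
  qed
qed

lemma card_criticals_le: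
  assumes G: "pair_graph G" and "\<And>v. v \<in> pverts G \<Longrightarrow> nbhd G v \<noteq> {}"
  shows "card (criticals (dominating_sets G)) \<le> card (nonmembers (pverts G) (dominating_sets G))"
proof -
  interpret pair_graph G by fact
  have "\<forall>p\<in>criticals (dominating_sets G). \<exists>q. charge G p q"
    using charge_total[OF assms] by auto
  then obtain f where f: "\<And>p. p \<in> criticals (dominating_sets G) \<Longrightarrow> charge G p (f p)"
    by metis
  have "inj_on f (criticals (dominating_sets G))"
    using f charge_inj[OF G] by (metis inj_onI)
  moreover have "f ` criticals (dominating_sets G) \<subseteq> nonmembers (pverts G) (dominating_sets G)"
    using f charge_nonmember[OF G] by blast
  moreover have "finite (nonmembers (pverts G) (dominating_sets G))"
    unfolding nonmembers_def using finite_dominating_sets[OF G] pair_finite_verts by auto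
  ultimately show ?thesis by (rule card_inj_on_le)
qed

section \<open>Bounds on the average order\<close>

lemma card_dominating_sets_pos:
  assumes "pair_graph G"
  shows "card (dominating_sets G) > 0"
  using finite_dominating_sets[OF assms] pverts_in_dominating_sets[OF assms] card_gt_0_iff by blast

lemma avd_eq_card_members:
  assumes "pair_graph G"
  shows "avd G = real (card (members (dominating_sets G))) / real (card (dominating_sets G))"
proof -
  interpret pair_graph G by fact
  have "finite S" if "S \<in> dominating_sets G" for S
    using that finite_subset[OF _ pair_finite_verts]
    by (auto simp: dominating_sets_def dominating_set_def)
  then show ?thesis
    using finite_dominating_sets[OF assms] by (simp add: avd_def members_def)
qed

lemma avd_bounds:
  assumes G: "pair_graph G"
  shows avd_ge: "avd G \<ge> real (card (pverts G)) / 2"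
    and avd_le: "(\<And>v. v \<in> pverts G \<Longrightarrow> nbhd G v \<noteq> {}) \<Longrightarrow> avd G \<le> 2 / 3 * real (card (pverts G))"
proof -
  interpret pair_graph G by fact
  let ?D = "dominating_sets G" and ?n = "card (pverts G)"
  have sub: "?D \<subseteq> Pow (pverts G)" using dominating_sets_iff[OF G] by blast
  have add: "card (members ?D) + card (nonmembers (pverts G) ?D) = card ?D * ?n"
    by (rule card_members_add_nonmembers[OF pair_finite_verts sub])
  have up: "card (members ?D) = card (criticals ?D) + card (nonmembers (pverts G) ?D)"
    by (rule card_members_upset[OF pair_finite_verts sub dominating_sets_upset[OF G]])
  have "card ?D * ?n \<le> 2 * card (members ?D)"
    using add up by linarith
  then have "real (card ?D) * real ?n \<le> 2 * real (card (members ?D))"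
    using of_nat_mono by fastforce
  then show "avd G \<ge> real ?n / 2"
    using card_dominating_sets_pos[OF G] by (simp add: avd_eq_card_members[OF G] field_simps)
  assume nbhd: "\<And>v. v \<in> pverts G \<Longrightarrow> nbhd G v \<noteq> {}"
  \<comment> \<open>With \<open>m\<close> members and \<open>k\<close> non-members, criticals
    numbering at most \<open>k\<close> give \<open>m \<le> 2 * k\<close>, hence
    \<open>3 * m \<le> 2 * (m + k)\<close>.\<close>
  have "3 * card (members ?D) \<le> 2 * (card ?D * ?n)"
    using card_criticals_le[OF G nbhd] add up by linarith
  then have "3 * real (card (members ?D)) \<le> 2 * (real (card ?D) * real ?n)"
    by (metis of_nat_le_iff of_nat_mult of_nat_numeral)
  then show "avd G \<le> 2 / 3 * real ?n"
    using card_dominating_sets_pos[OF G] by (simp add: avd_eq_card_members[OF G] field_simps)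
qed

section \<open>Isomorphic copies and disjoint unions\<close>

text \<open>Applied to injections, this makes isomorphic copies: \<open>prod.swap\<close> exchanges
  the factors of a product, and \<open>Pair g\<close> places \<open>H\<close> as the layer over
  \<open>g\<close>.\<close>

definition map_graph :: "('a \<Rightarrow> 'b) \<Rightarrow> 'a pair_pre_digraph \<Rightarrow> 'b pair_pre_digraph" where
  "map_graph f G = \<lparr>pverts = f ` pverts G, parcs = map_prod f f ` parcs G\<rparr>"

lemma pair_graph_map_graph:
  assumes "pair_graph G" "inj f"
  shows "pair_graph (map_graph f G)"
proof -
  interpret pair_graph G by fact
  show ?thesis
  proof unfold_locales
    fix e assume "e \<in> parcs (map_graph f G)"
    then show "fst e \<in> pverts (map_graph f G)" "snd e \<in> pverts (map_graph f G)" "fst e \<noteq> snd e"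
      using wellformed' pair_no_loops injD[OF assms(2)] by (force simp: map_graph_def)+
  next
    show "finite (pverts (map_graph f G))" "finite (parcs (map_graph f G))"
      using pair_finite_verts pair_finite_arcs by (auto simp: map_graph_def)
    show "symmetric (with_proj (map_graph f G))"
      using pair_sym_arcs by (force simp: symmetric_def sym_def map_graph_def)
  qed
qed

lemma dominating_sets_map_graph:
  assumes "inj f"
  shows "dominating_sets (map_graph f G) = (`) f ` dominating_sets G"
proof -
  have nb: "closed_nbhd_set (map_graph f G) (f ` S) = f ` closed_nbhd_set G S" for S
    using injD[OF assms]
    by (force simp: closed_nbhd_set_def closed_nbhd_def nbhd_def map_graph_def)
  have "dominating_set (map_graph f G) (f ` S) \<longleftrightarrow> dominating_set G S" for S
    unfolding dominating_set_def nb using assms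
    by (simp add: map_graph_def inj_image_subset_iff inj_image_eq_iff)
  moreover have "\<exists>S. T = f ` S" if "dominating_set (map_graph f G) T" for T
    using that by (auto simp: dominating_set_def map_graph_def subset_image_iff)
  ultimately show ?thesis
    unfolding dominating_sets_def by blast
qed

lemma avd_map_graph:
  assumes "inj f"
  shows "avd (map_graph f G) = avd G"
proof -
  have "inj_on ((`) f) (dominating_sets G)"
    using assms by (auto simp: inj_on_def inj_image_eq_iff)
  then show ?thesis
    using assms unfolding avd_def dominating_sets_map_graph[OF assms]
    by (simp add: sum.reindex card_image inj_on_subset)
qed

text \<open>A union within one vertex type, not a sum type, so that deleting an isolated vertex
  stays in the type on which the induction runs. Disjointness is a premise where it matters.\<close>

definition graph_union :: "'a pair_pre_digraph \<Rightarrow> 'a pair_pre_digraph \<Rightarrow> 'a pair_pre_digraph" where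
  "graph_union G H = \<lparr>pverts = pverts G \<union> pverts H, parcs = parcs G \<union> parcs H\<rparr>"

text \<open>No arc joins the two parts, so closed neighbourhoods stay within their part, and a set
  dominates the union exactly when both of its traces dominate.\<close>

lemma dominating_sets_graph_union:
  assumes "pair_graph G" "pair_graph H" "pverts G \<inter> pverts H = {}"
  shows "bij_betw (\<lambda>(A, B). A \<union> B) (dominating_sets G \<times> dominating_sets H)
    (dominating_sets (graph_union G H))"
proof (rule bij_betwI[where g = "\<lambda>S. (S \<inter> pverts G, S \<inter> pverts H)"])
  interpret G: pair_graph G by fact
  interpret H: pair_graph H by fact
  have cn: "closed_nbhd_set (graph_union G H) (A \<union> B) = closed_nbhd_set G A \<union> closed_nbhd_set H B"
    if "A \<subseteq> pverts G" "B \<subseteq> pverts H" for A B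
    using that assms(3) G.wellformed' H.wellformed'
    unfolding closed_nbhd_set_def closed_nbhd_def nbhd_def graph_union_def by fastforce
  have sub: "closed_nbhd_set G A \<subseteq> pverts G" if "A \<subseteq> pverts G" for A
    using that G.wellformed' unfolding closed_nbhd_set_def closed_nbhd_def nbhd_def by blast
  have sub': "closed_nbhd_set H B \<subseteq> pverts H" if "B \<subseteq> pverts H" for B
    using that H.wellformed' unfolding closed_nbhd_set_def closed_nbhd_def nbhd_def by blast
  show "(\<lambda>(A, B). A \<union> B) \<in> dominating_sets G \<times> dominating_sets H \<rightarrow>
      dominating_sets (graph_union G H)"
    using cn by (auto simp: dominating_sets_def dominating_set_def graph_union_def)
  show "(\<lambda>S. (S \<inter> pverts G, S \<inter> pverts H)) \<in> dominating_sets (graph_union G H) \<rightarrow>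
      dominating_sets G \<times> dominating_sets H"
  proof
    fix S assume "S \<in> dominating_sets (graph_union G H)"
    then have S: "S \<subseteq> pverts G \<union> pverts H"
      "closed_nbhd_set (graph_union G H) S = pverts G \<union> pverts H"
      by (auto simp: dominating_sets_def dominating_set_def graph_union_def)
    have "S = S \<inter> pverts G \<union> S \<inter> pverts H" using S by blast
    then have "closed_nbhd_set G (S \<inter> pverts G) \<union> closed_nbhd_set H (S \<inter> pverts H) =
        pverts G \<union> pverts H"
      using cn[of "S \<inter> pverts G" "S \<inter> pverts H"] S by simp
    then show "(S \<inter> pverts G, S \<inter> pverts H) \<in> dominating_sets G \<times> dominating_sets H"
      using assms(3) sub[of "S \<inter> pverts G"] sub'[of "S \<inter> pverts H"]
      unfolding dominating_sets_def dominating_set_def by blast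
  qed
  show "(\<lambda>S. (S \<inter> pverts G, S \<inter> pverts H)) ((\<lambda>(A, B). A \<union> B) x) = x"
    if "x \<in> dominating_sets G \<times> dominating_sets H" for x
    using that assms(3) by (auto simp: dominating_sets_def dominating_set_def)
  show "(\<lambda>(A, B). A \<union> B) (S \<inter> pverts G, S \<inter> pverts H) = S"
    if "S \<in> dominating_sets (graph_union G H)" for S
    using that by (auto simp: dominating_sets_def dominating_set_def graph_union_def)
qed

text \<open>The two traces vary independently and their sizes add, so the averages add.\<close>

lemma avd_graph_union:
  assumes "pair_graph G" "pair_graph H" "pverts G \<inter> pverts H = {}"
  shows "avd (graph_union G H) = avd G + avd H"
proof -
  interpret G: pair_graph G by fact
  interpret H: pair_graph H by fact
  let ?D = "dominating_sets G" and ?E = "dominating_sets H"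
  note bij = dominating_sets_graph_union[OF assms]
  have c: "card (A \<union> B) = card A + card B" if "A \<in> ?D" "B \<in> ?E" for A B
  proof (rule card_Un_disjoint)
    show "finite A" "finite B" "A \<inter> B = {}"
      using that assms(3) finite_subset[OF _ G.pair_finite_verts] finite_subset[OF _ H.pair_finite_verts]
      by (auto simp: dominating_sets_def dominating_set_def)
  qed
  have "card (dominating_sets (graph_union G H)) = card ?D * card ?E"
    using bij_betw_same_card[OF bij] by (simp add: card_cartesian_product)
  moreover have "(\<Sum>S\<in>dominating_sets (graph_union G H). real (card S)) =
      (\<Sum>(A, B)\<in>?D \<times> ?E. real (card A) + real (card B))"
    unfolding sum.reindex_bij_betw[OF bij, symmetric] using c by (intro sum.cong) auto
  moreover have "\<dots> = (\<Sum>A\<in>?D. real (card A)) * card ?E + card ?D * (\<Sum>B\<in>?E. real (card B))"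
    by (simp add: sum.cartesian_product[symmetric] sum.distrib sum_distrib_left sum_distrib_right
        mult.commute)
  ultimately show ?thesis
    using card_dominating_sets_pos[OF assms(1)] card_dominating_sets_pos[OF assms(2)]
    by (simp add: avd_def field_simps)
qed

section \<open>Cartesian products and isolated vertices\<close>

lemma cartesian_product_commute:
  "G \<box> H = map_graph prod.swap (H \<box> G)"
  unfolding cartesian_product_def map_graph_def by (auto simp: image_iff)

lemma avd_cartesian_product_commute: "avd (G \<box> H) = avd (H \<box> G)"
  by (metis cartesian_product_commute avd_map_graph inj_swap)

definition single_vertex :: "'a \<Rightarrow> 'a pair_pre_digraph" where
  "single_vertex g = \<lparr>pverts = {g}, parcs = {}\<rparr>"

lemma pair_graph_single_vertex: "pair_graph (single_vertex g)"
  by unfold_locales (auto simp: single_vertex_def symmetric_def sym_def)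

lemma avd_single_vertex: "avd (single_vertex g) = 1"
proof -
  have "dominating_sets (single_vertex g) = {{g}}"
    by (auto simp: dominating_sets_iff[OF pair_graph_single_vertex])
      (auto simp: single_vertex_def nbhd_def)
  then show ?thesis by (simp add: avd_def)
qed

lemma isolated_vertex_split:
  assumes G: "pair_graph G" and g: "g \<in> pverts G" "nbhd G g = {}"
  obtains G' where "pair_graph G'" "g \<notin> pverts G'" "parcs G' = parcs G"
    "G = graph_union (single_vertex g) G'"
proof
  interpret pair_graph G by fact
  let ?G' = "\<lparr>pverts = pverts G - {g}, parcs = parcs G\<rparr>"
  \<comment> \<open>No arc meets \<open>g\<close>, so deleting \<open>g\<close> keeps all arcs; in
    particular the graph stays non-empty.\<close>
  have "(x, g) \<notin> parcs G" "(g, x) \<notin> parcs G" for x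
    using g(2) nbhd_sym[OF G, of x g] by (auto simp: nbhd_def)
  then show "pair_graph ?G'"
    using wellformed' pair_no_loops pair_finite_verts pair_finite_arcs pair_sym_arcs
    by unfold_locales (force simp: symmetric_def)+
  show "G = graph_union (single_vertex g) ?G'"
    using g(1) by (simp add: graph_union_def single_vertex_def insert_absorb)
qed auto

lemma cartesian_product_isolated_vertex:
  "graph_union (single_vertex g) G \<box> H = graph_union (map_graph (Pair g) H) (G \<box> H)"
  unfolding cartesian_product_def graph_union_def map_graph_def single_vertex_def
  by (auto simp: image_iff)

lemma avd_cartesian_product_isolated_vertex:
  assumes "pair_graph G" "pair_graph H" "g \<notin> pverts G"
  shows "avd (graph_union (single_vertex g) G \<box> H) = avd H + avd (G \<box> H)"
proof -
  have "avd (graph_union (map_graph (Pair g) H) (G \<box> H)) = avd (map_graph (Pair g) H) + avd (G \<box> H)"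
    using assms by (intro avd_graph_union pair_graph_map_graph pair_graph_cartesian_product)
      (auto simp: map_graph_def cartesian_product_def inj_on_def)
  then show ?thesis
    using assms by (simp add: cartesian_product_isolated_vertex avd_map_graph inj_on_def)
qed

section \<open>Removing isolated vertices and combining the bounds\<close>

text \<open>Induction on the order of the left factor with \<open>H\<close> fixed. The case without
  isolated vertices is the premise \<open>base\<close>, so that the reduction can be applied to each
  factor in turn.\<close>

lemma avd_cartesian_product_gt_left:
  fixes G :: "'a pair_pre_digraph" and H :: "'b pair_pre_digraph"
  assumes "pair_graph G" "parcs G \<noteq> {}" and H: "pair_graph H"
    and base: "\<And>G :: 'a pair_pre_digraph. \<lbrakk>pair_graph G; parcs G \<noteq> {}; \<And>v. v \<in> pverts G \<Longrightarrow> nbhd G v \<noteq> {}\<rbrakk>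
      \<Longrightarrow> avd (G \<box> H) > avd G * avd H"
  shows "avd (G \<box> H) > avd G * avd H"
  using assms(1,2)
proof (induction "card (pverts G)" arbitrary: G rule: less_induct)
  case less
  interpret pair_graph G by fact
  show ?case
  proof (cases "\<forall>v\<in>pverts G. nbhd G v \<noteq> {}")
    case True
    then show ?thesis by (intro base less.prems) auto
  next
    case False
    then obtain g where "g \<in> pverts G" "nbhd G g = {}" by blast
    then obtain G' where G': "pair_graph G'" "g \<notin> pverts G'" "parcs G' = parcs G"
      "G = graph_union (single_vertex g) G'"
      using isolated_vertex_split[OF less.prems(1)] by metis
    have "pverts G = insert g (pverts G')"
      by (subst G'(4)) (simp add: graph_union_def single_vertex_def)
    then have "card (pverts G') < card (pverts G)"
      using G' pair_finite_verts by simp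
    then have "avd (G' \<box> H) > avd G' * avd H"
      using less.hyps[of G'] G' less.prems by simp
    moreover have "avd (G \<box> H) = avd H + avd (G' \<box> H)"
      using avd_cartesian_product_isolated_vertex[OF G'(1) H G'(2)] G'(4) by simp
    moreover have "avd G = 1 + avd G'"
      unfolding G'(4) avd_single_vertex[of g, symmetric] using G'(1,2)
      by (intro avd_graph_union pair_graph_single_vertex) (simp_all add: single_vertex_def)
    \<comment> \<open>Both sides exceed their values for \<open>G'\<close> by exactly
      \<open>avd H\<close>.\<close>
    ultimately show ?thesis by (simp add: algebra_simps)
  qed
qed

lemma avd_cartesian_product_gt_no_isolated:
  assumes G: "pair_graph G" "parcs G \<noteq> {}" "\<And>v. v \<in> pverts G \<Longrightarrow> nbhd G v \<noteq> {}"
    and H: "pair_graph H" "parcs H \<noteq> {}" "\<And>v. v \<in> pverts H \<Longrightarrow> nbhd H v \<noteq> {}"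
  shows "avd (G \<box> H) > avd G * avd H"
proof -
  interpret G: pair_graph G by fact
  interpret H: pair_graph H by fact
  let ?m = "real (card (pverts G))" and ?n = "real (card (pverts H))"
  have "pverts G \<noteq> {}" "pverts H \<noteq> {}"
    using G(2) H(2) G.wellformed' H.wellformed' by fastforce+
  then have pos: "?m * ?n > 0"
    using G.pair_finite_verts H.pair_finite_verts by (simp add: card_gt_0_iff)
  have "avd G * avd H \<le> (2 / 3 * ?m) * (2 / 3 * ?n)"
  proof (rule mult_mono)
    show "0 \<le> avd H" by (simp add: avd_def sum_nonneg)
  qed (use avd_le G H in auto)
  \<comment> \<open>The factor 4/9 is below 1/2, and strictness needs \<open>?m * ?n\<close>
    positive.\<close>
  also have "\<dots> < ?m * ?n / 2" using pos by simp
  also have "\<dots> \<le> avd (G \<box> H)"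
    using avd_ge[OF pair_graph_cartesian_product[OF G(1) H(1)]]
    by (simp add: cartesian_product_def card_cartesian_product)
  finally show ?thesis .
qed

theorem theorem3p1:
  fixes G :: "'a pair_pre_digraph" and H :: "'b pair_pre_digraph"
  assumes "pair_graph G" and "pair_graph H"
    and "parcs G \<noteq> {}" and "parcs H \<noteq> {}"
  shows "avd (G \<box> H) > avd G * avd H"
proof (rule avd_cartesian_product_gt_left[OF assms(1,3,2)])
  fix G :: "'a pair_pre_digraph"
  assume G: "pair_graph G" "parcs G \<noteq> {}" "\<And>v. v \<in> pverts G \<Longrightarrow> nbhd G v \<noteq> {}"
  \<comment> \<open>The same reduction with the factors exchanged: now \<open>H\<close> is on the
    left and sheds its isolated vertices, while \<open>G\<close> has none.\<close>
  have "avd (H \<box> G) > avd H * avd G"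
    by (rule avd_cartesian_product_gt_left[OF assms(2,4) G(1)])
      (rule avd_cartesian_product_gt_no_isolated[OF _ _ _ G])
  then show "avd (G \<box> H) > avd G * avd H"
    by (simp add: avd_cartesian_product_commute[of G H] mult.commute)
qed

end
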